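(* Let $k$ be a field and let $V$ and $P$ be two $k$-vector spaces. Then there exists a bijection $$\mathrm{Ext}(P_0, V_0) \ \cong \ \bigsqcup_{(\triangleleft, \triangleright)} \mathrm{DH}^2\bigl((P, \triangleleft, \triangleright), V\bigr),$$ where the disjoint union (coproduct in the category of sets) is over all discrete bimodule structures $(P, \triangleleft, \triangleright)$ over $V$. The explicit bijection (from right to left) sends the class $\overline{\theta} \in \mathrm{DH}^2((P, \triangleleft, \triangleright), V)$ of a discrete $(\triangleleft, \triangleright)$-cocycle $\theta$ to the equivalence class of the extension of $P_0$ by $V_0$ given by the metabelian product $P \star_{(\triangleleft, \triangleright, \theta)} V$ together with its canonical maps $i_V$ and $\pi_P$.
   Context: All vector spaces, algebras, linear and bilinear maps are over an arbitrary field $k$; algebras are associative, not necessarily unital. For a vector space $V$, $V_0$ denotes $V$ with the trivial multiplication $xy = 0$. An extension of an algebra $Q$ by an algebra $W$ is a triple $(A, i, \pi)$ with $A$ an algebra and $i : W \to A$, $\pi : A \to Q$ algebra morphisms such that $0 \to W \xrightarrow{i} A \xrightarrow{\pi} Q \to 0$ is exact. Two extensions $(A, i, \pi)$ and $(B, j, \rho)$ of $Q$ by $W$ are equivalent if there is an algebra morphism $\varphi : A \to B$ with $\varphi \circ i = j$ and $\rho \circ \varphi = \pi$ (such $\varphi$ is automatically an isomorphism). $\mathrm{Ext}(Q, W)$ is the set of equivalence classes of extensions of $Q$ by $W$. A discrete bimodule structure $(P, \triangleleft, \triangleright)$ over $V$ is a pair of bilinear maps $\triangleleft : V \times P \to V$,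 $\triangleright : P \times V \to V$ such that for all $p, q \in P$, $x \in V$: $$(x \triangleleft p) \triangleleft q = p \triangleright (q \triangleright x) = 0, \qquad p \triangleright (x \triangleleft q) = (p \triangleright x) \triangleleft q.$$ A discrete $(\triangleleft, \triangleright)$-cocycle is a bilinear map $\theta : P \times P \to V$ with $p \triangleright \theta(q, r) = \theta(p, q) \triangleleft r$ for all $p, q, r \in P$; the space of these is $\mathrm{DZ}^2((P, \triangleleft, \triangleright), V)$. Two such cocycles $\theta, \theta'$ are cohomologous, $\theta \equiv \theta'$, if there is a linear map $r : P \to V$ with $\theta(p, q) = \theta'(p, q) + p \triangleright r(q) + r(p) \triangleleft q$ for all $p, q \in P$; this is an equivalence relation, and $\mathrm{DH}^2((P, \triangleleft, \triangleright), V) := \mathrm{DZ}^2((P, \triangleleft, \triangleright), V)/\equiv$. Given such $(\triangleleft, \triangleright, \theta)$, the metabelian product $P \star_{(\triangleleft, \triangleright, \theta)} V$ is the vector space $P \times V$ with the (associative) multiplication $(p, x) \star (q, y) := (0, \ \theta(p, q) + p \triangleright y + x \triangleleft q)$. It is an extension of $P_0$ by $V_0$ via $i_V(x) = (0, x)$ and $\pi_P(p, x) = p$. *)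

theory Defs
  imports "HOL-Algebra.Module"
begin

text \<open>
  Vector spaces over a field \<open>K\<close> are the modules of the library: \<open>field K\<close> together with
  \<open>module K V\<close>. The record type of modules also has fields for a multiplication and a unit;
  the locale \<open>module\<close> does not constrain them. For algebras the multiplication field is used,
  and the unit field is ignored throughout, since algebras need not be unital.
\<close>

section \<open>Linear and bilinear maps, algebras\<close>

definition linear_maps ::
    "('k, 'm) ring_scheme \<Rightarrow> ('k, 'u) module \<Rightarrow> ('k, 'w) module \<Rightarrow> ('u \<Rightarrow> 'w) set" where
  "linear_maps K U W = {f \<in> carrier U \<rightarrow> carrier W.
     (\<forall>x\<in>carrier U. \<forall>y\<in>carrier U. f (x \<oplus>\<^bsub>U\<^esub> y) = f x \<oplus>\<^bsub>W\<^esub> f y) \<and>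
     (\<forall>a\<in>carrier K. \<forall>x\<in>carrier U. f (a \<odot>\<^bsub>U\<^esub> x) = a \<odot>\<^bsub>W\<^esub> f x)}"

text \<open>
  Bilinear maps are required to be extensional (\<open>undefined\<close> outside the product of the carriers),
  so that elements of this set are equal iff they agree as maps on the carriers. This matters
  because bilinear maps index the disjoint union below.
\<close>

definition bilinear_maps ::
    "('k, 'm) ring_scheme \<Rightarrow> ('k, 'u) module \<Rightarrow> ('k, 'v) module \<Rightarrow> ('k, 'w) module
      \<Rightarrow> ('u \<times> 'v \<Rightarrow> 'w) set" where
  "bilinear_maps K U V W = {f \<in> carrier U \<times> carrier V \<rightarrow>\<^sub>E carrier W.
     (\<forall>x\<in>carrier U. (\<lambda>y. f (x, y)) \<in> linear_maps K V W) \<and>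
     (\<forall>y\<in>carrier V. (\<lambda>x. f (x, y)) \<in> linear_maps K U W)}"

text \<open>Associative, not necessarily unital or commutative, algebras over a field.\<close>

locale assoc_algebra = field K + module K A for K (structure) and A (structure) +
  assumes mult_closed:
      "\<lbrakk>x \<in> carrier A; y \<in> carrier A\<rbrakk> \<Longrightarrow> x \<otimes>\<^bsub>A\<^esub> y \<in> carrier A"
    and mult_assoc:
      "\<lbrakk>x \<in> carrier A; y \<in> carrier A; z \<in> carrier A\<rbrakk>
        \<Longrightarrow> (x \<otimes>\<^bsub>A\<^esub> y) \<otimes>\<^bsub>A\<^esub> z = x \<otimes>\<^bsub>A\<^esub> (y \<otimes>\<^bsub>A\<^esub> z)"
    and mult_add_left:
      "\<lbrakk>x \<in> carrier A; y \<in> carrier A; z \<in> carrier A\<rbrakk>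
        \<Longrightarrow> (x \<oplus>\<^bsub>A\<^esub> y) \<otimes>\<^bsub>A\<^esub> z = x \<otimes>\<^bsub>A\<^esub> z \<oplus>\<^bsub>A\<^esub> y \<otimes>\<^bsub>A\<^esub> z"
    and mult_add_right:
      "\<lbrakk>x \<in> carrier A; y \<in> carrier A; z \<in> carrier A\<rbrakk>
        \<Longrightarrow> x \<otimes>\<^bsub>A\<^esub> (y \<oplus>\<^bsub>A\<^esub> z) = x \<otimes>\<^bsub>A\<^esub> y \<oplus>\<^bsub>A\<^esub> x \<otimes>\<^bsub>A\<^esub> z"
    and mult_smult_left:
      "\<lbrakk>a \<in> carrier K; x \<in> carrier A; y \<in> carrier A\<rbrakk>
        \<Longrightarrow> (a \<odot>\<^bsub>A\<^esub> x) \<otimes>\<^bsub>A\<^esub> y = a \<odot>\<^bsub>A\<^esub> (x \<otimes>\<^bsub>A\<^esub> y)"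
    and mult_smult_right:
      "\<lbrakk>a \<in> carrier K; x \<in> carrier A; y \<in> carrier A\<rbrakk>
        \<Longrightarrow> x \<otimes>\<^bsub>A\<^esub> (a \<odot>\<^bsub>A\<^esub> y) = a \<odot>\<^bsub>A\<^esub> (x \<otimes>\<^bsub>A\<^esub> y)"

definition algebra_morphisms ::
    "('k, 'm) ring_scheme \<Rightarrow> ('k, 'a) module \<Rightarrow> ('k, 'b) module \<Rightarrow> ('a \<Rightarrow> 'b) set" where
  "algebra_morphisms K A B = {f \<in> linear_maps K A B.
     \<forall>x\<in>carrier A. \<forall>y\<in>carrier A. f (x \<otimes>\<^bsub>A\<^esub> y) = f x \<otimes>\<^bsub>B\<^esub> f y}"

definition trivial_algebra :: "('k, 'v) module \<Rightarrow> ('k, 'v) module" where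
  "trivial_algebra V = V\<lparr>mult := \<lambda>x y. \<zero>\<^bsub>V\<^esub>\<rparr>"


section \<open>Extensions\<close>

type_synonym ('k, 'w, 'a, 'q) extension = "('k, 'a) module \<times> ('w \<Rightarrow> 'a) \<times> ('a \<Rightarrow> 'q)"

text \<open>The last three conjuncts are exactness of \<open>0 \<rightarrow> W \<rightarrow> A \<rightarrow> Q \<rightarrow> 0\<close>.\<close>

definition is_extension ::
    "('k, 'm) ring_scheme \<Rightarrow> ('k, 'q) module \<Rightarrow> ('k, 'w) module
      \<Rightarrow> ('k, 'w, 'a, 'q) extension \<Rightarrow> bool" where
  "is_extension K Q W = (\<lambda>(A, i, \<pi>).
     assoc_algebra K A \<and> i \<in> algebra_morphisms K W A \<and> \<pi> \<in> algebra_morphisms K A Q \<and>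
     inj_on i (carrier W) \<and>
     i ` carrier W = {a \<in> carrier A. \<pi> a = \<zero>\<^bsub>Q\<^esub>} \<and>
     \<pi> ` carrier A = carrier Q)"

text \<open>
  The underlying sets of the two extensions may live in different types \<open>'a\<close> and \<open>'b\<close>.
\<close>

definition equivalent_extensions ::
    "('k, 'm) ring_scheme \<Rightarrow> ('k, 'w) module
      \<Rightarrow> ('k, 'w, 'a, 'q) extension \<Rightarrow> ('k, 'w, 'b, 'q) extension \<Rightarrow> bool" where
  "equivalent_extensions K W = (\<lambda>(A, i, \<pi>) (B, j, \<rho>).
     \<exists>\<phi>\<in>algebra_morphisms K A B.
       (\<forall>x\<in>carrier W. \<phi> (i x) = j x) \<and> (\<forall>a\<in>carrier A. \<rho> (\<phi> a) = \<pi> a))"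

text \<open>
  All extensions of \<open>Q\<close> by \<open>W\<close> form a proper class, so their equivalence classes are taken
  among the extensions whose underlying set consists of elements of a type \<open>'a\<close>. Every extension
  is in bijection with \<open>carrier Q \<times> carrier W\<close>; hence every type \<open>'a\<close> into which this product
  embeds contains a copy of every extension, and the choice of such a type is immaterial.
\<close>

definition Ext ::
    "('k, 'm) ring_scheme \<Rightarrow> ('k, 'q) module \<Rightarrow> ('k, 'w) module
      \<Rightarrow> ('k, 'w, 'a, 'q) extension set set" where
  "Ext K Q W = {E. is_extension K Q W E} //
     {(E, F). is_extension K Q W E \<and> is_extension K Q W F \<and> equivalent_extensions K W E F}"

text \<open>
  The class, among the extensions with underlying set in \<open>'b\<close>, of an extension with underlying
  set in a possibly different type \<open>'a\<close>.
\<close>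

definition extension_class ::
    "('k, 'm) ring_scheme \<Rightarrow> ('k, 'q) module \<Rightarrow> ('k, 'w) module
      \<Rightarrow> ('k, 'w, 'a, 'q) extension \<Rightarrow> ('k, 'w, 'b, 'q) extension set" where
  "extension_class K Q W E = {F. is_extension K Q W F \<and> equivalent_extensions K W E F}"


section \<open>Discrete bimodules and discrete cocycles\<close>

text \<open>
  A pair \<open>(l, r)\<close> stands for the bimodule structure with \<open>x \<triangleleft> p = l (x, p)\<close> and
  \<open>p \<triangleright> x = r (p, x)\<close>.
\<close>

definition discrete_bimodules ::
    "('k, 'm) ring_scheme \<Rightarrow> ('k, 'p) module \<Rightarrow> ('k, 'v) module
      \<Rightarrow> (('v \<times> 'p \<Rightarrow> 'v) \<times> ('p \<times> 'v \<Rightarrow> 'v)) set" where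
  "discrete_bimodules K P V = {(l, r).
     l \<in> bilinear_maps K V P V \<and> r \<in> bilinear_maps K P V V \<and>
     (\<forall>p\<in>carrier P. \<forall>q\<in>carrier P. \<forall>x\<in>carrier V.
        l (l (x, p), q) = \<zero>\<^bsub>V\<^esub> \<and> r (p, r (q, x)) = \<zero>\<^bsub>V\<^esub> \<and>
        r (p, l (x, q)) = l (r (p, x), q))}"

definition DZ2 ::
    "('k, 'm) ring_scheme \<Rightarrow> ('k, 'p) module \<Rightarrow> ('k, 'v) module
      \<Rightarrow> ('v \<times> 'p \<Rightarrow> 'v) \<times> ('p \<times> 'v \<Rightarrow> 'v) \<Rightarrow> ('p \<times> 'p \<Rightarrow> 'v) set" where
  "DZ2 K P V = (\<lambda>(l, r). {\<theta> \<in> bilinear_maps K P P V.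
     \<forall>p\<in>carrier P. \<forall>q\<in>carrier P. \<forall>s\<in>carrier P. r (p, \<theta> (q, s)) = l (\<theta> (p, q), s)})"

definition cohomologous ::
    "('k, 'm) ring_scheme \<Rightarrow> ('k, 'p) module \<Rightarrow> ('k, 'v) module
      \<Rightarrow> ('v \<times> 'p \<Rightarrow> 'v) \<times> ('p \<times> 'v \<Rightarrow> 'v)
      \<Rightarrow> (('p \<times> 'p \<Rightarrow> 'v) \<times> ('p \<times> 'p \<Rightarrow> 'v)) set" where
  "cohomologous K P V = (\<lambda>(l, r). {(\<theta>, \<theta>'). \<theta> \<in> DZ2 K P V (l, r) \<and> \<theta>' \<in> DZ2 K P V (l, r) \<and>
     (\<exists>f\<in>linear_maps K P V. \<forall>p\<in>carrier P. \<forall>q\<in>carrier P.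
        \<theta> (p, q) = \<theta>' (p, q) \<oplus>\<^bsub>V\<^esub> r (p, f q) \<oplus>\<^bsub>V\<^esub> l (f p, q))})"

definition DH2 ::
    "('k, 'm) ring_scheme \<Rightarrow> ('k, 'p) module \<Rightarrow> ('k, 'v) module
      \<Rightarrow> ('v \<times> 'p \<Rightarrow> 'v) \<times> ('p \<times> 'v \<Rightarrow> 'v) \<Rightarrow> ('p \<times> 'p \<Rightarrow> 'v) set set" where
  "DH2 K P V b = DZ2 K P V b // cohomologous K P V b"


section \<open>Metabelian products\<close>

definition metabelian_product ::
    "('k, 'p) module \<Rightarrow> ('k, 'v) module
      \<Rightarrow> ('v \<times> 'p \<Rightarrow> 'v) \<times> ('p \<times> 'v \<Rightarrow> 'v) \<Rightarrow> ('p \<times> 'p \<Rightarrow> 'v) \<Rightarrow> ('k, 'p \<times> 'v) module" where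
  "metabelian_product P V = (\<lambda>(l, r) \<theta>.
     \<lparr>carrier = carrier P \<times> carrier V,
      mult = \<lambda>(p, x) (q, y). (\<zero>\<^bsub>P\<^esub>, \<theta> (p, q) \<oplus>\<^bsub>V\<^esub> r (p, y) \<oplus>\<^bsub>V\<^esub> l (x, q)),
      one = undefined,
      zero = (\<zero>\<^bsub>P\<^esub>, \<zero>\<^bsub>V\<^esub>),
      add = \<lambda>(p, x) (q, y). (p \<oplus>\<^bsub>P\<^esub> q, x \<oplus>\<^bsub>V\<^esub> y),
      smult = \<lambda>a (p, x). (a \<odot>\<^bsub>P\<^esub> p, a \<odot>\<^bsub>V\<^esub> x)\<rparr>)"

definition metabelian_extension ::
    "('k, 'p) module \<Rightarrow> ('k, 'v) module
      \<Rightarrow> ('v \<times> 'p \<Rightarrow> 'v) \<times> ('p \<times> 'v \<Rightarrow> 'v) \<Rightarrow> ('p \<times> 'p \<Rightarrow> 'v)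
      \<Rightarrow> ('k, 'v, 'p \<times> 'v, 'p) extension" where
  "metabelian_extension P V b \<theta> =
     (metabelian_product P V b \<theta>, \<lambda>x. (\<zero>\<^bsub>P\<^esub>, x), \<lambda>(p, x). p)"

end

theory Submission
  imports Defs
begin

text \<open>
  Choosing a linear section \<open>s\<close> of the projection of an extension \<open>(A, i, \<pi>)\<close> of \<open>P\<^sub>0\<close> by \<open>V\<^sub>0\<close>
  identifies \<open>A\<close> with \<open>P \<times> V\<close> via \<open>(p, x) \<mapsto> s p + i x\<close>. All products in \<open>A\<close> lie in the kernel
  \<open>i V\<close> of \<open>\<pi>\<close> and \<open>i V \<cdot> i V = 0\<close>, so the products \<open>i x \<cdot> s p\<close>, \<open>s p \<cdot> i x\<close> and \<open>s p \<cdot> s q\<close> define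
  the bimodule structure and the cocycle, and associativity of \<open>A\<close> gives their axioms. An
  equivalence between two metabelian products preserves the bimodule structure and changes the
  cocycle by a coboundary.
\<close>

section \<open>Linear sections\<close>

lemma linear_mapsI:
  assumes "\<And>x. x \<in> carrier U \<Longrightarrow> f x \<in> carrier W"
    and "\<And>x y. \<lbrakk>x \<in> carrier U; y \<in> carrier U\<rbrakk> \<Longrightarrow> f (x \<oplus>\<^bsub>U\<^esub> y) = f x \<oplus>\<^bsub>W\<^esub> f y"
    and "\<And>a x. \<lbrakk>a \<in> carrier K; x \<in> carrier U\<rbrakk> \<Longrightarrow> f (a \<odot>\<^bsub>U\<^esub> x) = a \<odot>\<^bsub>W\<^esub> f x"
  shows "f \<in> linear_maps K U W"
  using assms by (auto simp: linear_maps_def)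

lemma linear_mapsD:
  assumes "f \<in> linear_maps K U W"
  shows "x \<in> carrier U \<Longrightarrow> f x \<in> carrier W"
    and "\<lbrakk>x \<in> carrier U; y \<in> carrier U\<rbrakk> \<Longrightarrow> f (x \<oplus>\<^bsub>U\<^esub> y) = f x \<oplus>\<^bsub>W\<^esub> f y"
    and "\<lbrakk>a \<in> carrier K; x \<in> carrier U\<rbrakk> \<Longrightarrow> f (a \<odot>\<^bsub>U\<^esub> x) = a \<odot>\<^bsub>W\<^esub> f x"
  using assms by (auto simp: linear_maps_def)

lemma linear_maps_zero:
  assumes "module K U" "module K W" "f \<in> linear_maps K U W"
  shows "f \<zero>\<^bsub>U\<^esub> = \<zero>\<^bsub>W\<^esub>"
proof -
  interpret U: module K U by fact
  interpret W: module K W by fact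
  have "f \<zero>\<^bsub>U\<^esub> = \<zero>\<^bsub>K\<^esub> \<odot>\<^bsub>W\<^esub> f \<zero>\<^bsub>U\<^esub>"
    using linear_mapsD(3)[OF assms(3), of "\<zero>\<^bsub>K\<^esub>" "\<zero>\<^bsub>U\<^esub>"] by simp
  then show ?thesis
    using linear_mapsD(1)[OF assms(3)] by simp
qed

lemma linear_maps_minus:
  assumes "module K U" "module K W" "f \<in> linear_maps K U W" "x \<in> carrier U"
  shows "f (\<ominus>\<^bsub>U\<^esub> x) = \<ominus>\<^bsub>W\<^esub> f x"
proof -
  interpret U: module K U by fact
  interpret W: module K W by fact
  have "f (\<ominus>\<^bsub>U\<^esub> x) \<oplus>\<^bsub>W\<^esub> f x = \<zero>\<^bsub>W\<^esub>"
    using linear_mapsD(2)[OF assms(3), of "\<ominus>\<^bsub>U\<^esub> x" x] assms(4)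
      linear_maps_zero[OF assms(1-3)] by (simp add: U.M.l_neg)
  then show ?thesis
    using linear_mapsD(1)[OF assms(3)] assms(4) by (simp add: W.M.minus_equality)
qed

text \<open>Two elements of \<open>G\<close> with the same image differ by an element of
  \<open>G\<close> that \<open>f\<close> kills. Since \<open>G\<close> is a submodule, the kernel
  condition is needed only inside \<open>G\<close>, not on all of \<open>U\<close>.\<close>

lemma linear_maps_injI:
  assumes "module K U" "module K W" "f \<in> linear_maps K U W" "submodule G K U"
    and "\<And>x. \<lbrakk>x \<in> G; f x = \<zero>\<^bsub>W\<^esub>\<rbrakk> \<Longrightarrow> x = \<zero>\<^bsub>U\<^esub>"
  shows "inj_on f G"
proof (rule inj_onI)
  interpret U: module K U by fact
  interpret W: module K W by fact
  note G = U.submoduleE[OF assms(4)]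
  fix x y assume xy: "x \<in> G" "y \<in> G" "f x = f y"
  then have c: "x \<in> carrier U" "y \<in> carrier U"
    using G(1) by auto
  have "f (x \<oplus>\<^bsub>U\<^esub> \<ominus>\<^bsub>U\<^esub> y) = \<zero>\<^bsub>W\<^esub>"
    using c xy(3) linear_mapsD(1,2)[OF assms(3)] linear_maps_minus[OF assms(1-3)]
    by (simp add: W.M.r_neg)
  then have "x \<oplus>\<^bsub>U\<^esub> \<ominus>\<^bsub>U\<^esub> y = \<zero>\<^bsub>U\<^esub>"
    using assms(5) G(3,5) xy by blast
  then show "x = y"
    using c by (metis U.M.add.inv_closed U.M.minus_equality U.M.minus_minus)
qed

text \<open>Any two elements of the union already lie in one member of the chain, namely the larger
  of the two that contain them. This provides the upper bounds for Zorn's lemma.\<close>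

lemma submodule_Union_chain:
  assumes "module K U" "\<C> \<noteq> {}" "subset.chain {G. submodule G K U} \<C>"
  shows "submodule (\<Union>\<C>) K U"
proof -
  interpret U: module K U by fact
  have sub: "submodule G K U" if "G \<in> \<C>" for G
    using assms(3) that by (auto simp: subset.chain_def)
  show ?thesis
  proof (rule U.submoduleI)
    show "\<Union>\<C> \<subseteq> carrier U"
      using U.submoduleE(1)[OF sub] by blast
    show "\<zero>\<^bsub>U\<^esub> \<in> \<Union>\<C>"
      using assms(2) sub subgroup.one_closed[OF submodule.axioms(1)] by fastforce
    show "\<ominus>\<^bsub>U\<^esub> a \<in> \<Union>\<C>" if "a \<in> \<Union>\<C>" for a
      using that U.submoduleE(3)[OF sub] by blast
    show "c \<odot>\<^bsub>U\<^esub> x \<in> \<Union>\<C>" if "c \<in> carrier K" "x \<in> \<Union>\<C>" for c x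
      using that U.submoduleE(4)[OF sub] by blast
    fix a b assume "a \<in> \<Union>\<C>" "b \<in> \<Union>\<C>"
    then obtain G H where GH: "G \<in> \<C>" "H \<in> \<C>" "a \<in> G" "b \<in> H"
      by blast
    then have "G \<subseteq> H \<or> H \<subseteq> G"
      using assms(3) by (auto simp: subset_chain_def)
    then show "a \<oplus>\<^bsub>U\<^esub> b \<in> \<Union>\<C>"
      using GH U.submoduleE(5)[OF sub] by blast
  qed
qed

text \<open>The submodule generated by \<open>G\<close> and \<open>a\<close>; it serves to enlarge a
  supposedly maximal \<open>G\<close>.\<close>

lemma submodule_adjoin:
  assumes "module K U" "submodule G K U" "a \<in> carrier U"
  shows "submodule {g \<oplus>\<^bsub>U\<^esub> c \<odot>\<^bsub>U\<^esub> a |g c. g \<in> G \<and> c \<in> carrier K} K U" (is "submodule ?H K U")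
proof -
  interpret U: module K U by fact
  note G = U.submoduleE[OF assms(2)]
  have mem: "x \<in> ?H" if "x = g \<oplus>\<^bsub>U\<^esub> c \<odot>\<^bsub>U\<^esub> a" "g \<in> G" "c \<in> carrier K" for x g c
    using that by blast
  show ?thesis
  proof (rule U.submoduleI)
    show "?H \<subseteq> carrier U"
      using G(1) assms(3) by auto
    have "\<zero>\<^bsub>U\<^esub> \<in> G"
      using subgroup.one_closed[OF submodule.axioms(1)[OF assms(2)]] by simp
    then show "\<zero>\<^bsub>U\<^esub> \<in> ?H"
      using assms(3) by (intro mem[of _ "\<zero>\<^bsub>U\<^esub>" "\<zero>\<^bsub>K\<^esub>"]) auto
    fix x assume "x \<in> ?H"
    then obtain g c where x: "x = g \<oplus>\<^bsub>U\<^esub> c \<odot>\<^bsub>U\<^esub> a" "g \<in> G" "c \<in> carrier K"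
      by blast
    with G(1) have g: "g \<in> carrier U"
      by blast
    show "\<ominus>\<^bsub>U\<^esub> x \<in> ?H"
      using x g assms(3) G(3)
      by (intro mem[of _ "\<ominus>\<^bsub>U\<^esub> g" "\<ominus>\<^bsub>K\<^esub> c"]) (auto simp: U.smult_l_minus U.M.minus_add)
    show "d \<odot>\<^bsub>U\<^esub> x \<in> ?H" if "d \<in> carrier K" for d
      using x g that assms(3) G(4)
      by (intro mem[of _ "d \<odot>\<^bsub>U\<^esub> g" "d \<otimes>\<^bsub>K\<^esub> c"]) (auto simp: U.smult_r_distr U.smult_assoc1)
    fix y assume "y \<in> ?H"
    then obtain g' c' where y: "y = g' \<oplus>\<^bsub>U\<^esub> c' \<odot>\<^bsub>U\<^esub> a" "g' \<in> G" "c' \<in> carrier K"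
      by blast
    with G(1) have g': "g' \<in> carrier U"
      by blast
    show "x \<oplus>\<^bsub>U\<^esub> y \<in> ?H"
      using x y g g' assms(3) G(5)
      by (intro mem[of _ "g \<oplus>\<^bsub>U\<^esub> g'" "c \<oplus>\<^bsub>K\<^esub> c'"]) (auto simp: U.smult_l_distr U.M.add.m_ac)
  qed
qed

text \<open>
  A submodule that is maximal among those meeting the kernel trivially is mapped onto the
  quotient, so its inverse is a linear section.
\<close>

lemma linear_section_exists:
  assumes "field K" "module K U" "module K W" "f \<in> linear_maps K U W" "f ` carrier U = carrier W"
  obtains s where "s \<in> linear_maps K W U" "\<And>w. w \<in> carrier W \<Longrightarrow> f (s w) = w"
proof -
  interpret K: field K by fact
  interpret U: module K U by fact
  interpret W: module K W by fact
  note f = linear_mapsD[OF assms(4)]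
  note f0 = linear_maps_zero[OF assms(2-4)]
  define \<A> where "\<A> = {G. submodule G K U \<and> (\<forall>x\<in>G. f x = \<zero>\<^bsub>W\<^esub> \<longrightarrow> x = \<zero>\<^bsub>U\<^esub>)}"
  have "submodule {\<zero>\<^bsub>U\<^esub>} K U"
    by (rule U.submoduleI) auto
  then have "\<A> \<noteq> {}"
    by (auto simp: \<A>_def)
  \<comment> \<open>Meeting the kernel trivially is a condition on single elements, so it passes
    from the members of a chain to their union.\<close>
  moreover have "\<Union>\<C> \<in> \<A>" if "\<C> \<noteq> {}" "subset.chain \<A> \<C>" for \<C>
  proof -
    have "subset.chain {G. submodule G K U} \<C>"
      using that(2) by (auto simp: subset_chain_def \<A>_def)
    then have "submodule (\<Union>\<C>) K U"
      by (rule submodule_Union_chain[OF assms(2) that(1)])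
    then show ?thesis
      using that(2) by (auto simp: subset_chain_def \<A>_def)
  qed
  ultimately obtain G where G: "G \<in> \<A>" "\<And>H. \<lbrakk>H \<in> \<A>; G \<subseteq> H\<rbrakk> \<Longrightarrow> H = G"
    using subset_Zorn_nonempty[of \<A>] by metis
  then have subG: "submodule G K U" and ker: "\<And>x. \<lbrakk>x \<in> G; f x = \<zero>\<^bsub>W\<^esub>\<rbrakk> \<Longrightarrow> x = \<zero>\<^bsub>U\<^esub>"
    by (auto simp: \<A>_def)
  note G' = U.submoduleE[OF subG]
  have G0: "\<zero>\<^bsub>U\<^esub> \<in> G"
    using subgroup.one_closed[OF submodule.axioms(1)[OF subG]] by simp
  have inj: "inj_on f G"
    by (rule linear_maps_injI[OF assms(2-4) subG ker])
  have surj: "f ` G = carrier W"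
  proof (rule ccontr)
    assume "f ` G \<noteq> carrier W"
    moreover have "f ` G \<subseteq> carrier W"
      using f(1) G'(1) by blast
    ultimately obtain w where w: "w \<in> carrier W" "w \<notin> f ` G"
      by blast
    from w(1) obtain a where "a \<in> carrier U" "w = f a"
      unfolding assms(5)[symmetric] by (rule imageE)
    with w(2) have a: "a \<in> carrier U" "f a \<notin> f ` G"
      by simp_all
    define H where "H = {g \<oplus>\<^bsub>U\<^esub> c \<odot>\<^bsub>U\<^esub> a |g c. g \<in> G \<and> c \<in> carrier K}"
    have "x = \<zero>\<^bsub>U\<^esub>" if xH: "x \<in> H" and fx: "f x = \<zero>\<^bsub>W\<^esub>" for x
    proof -
      obtain g c where x: "x = g \<oplus>\<^bsub>U\<^esub> c \<odot>\<^bsub>U\<^esub> a" "g \<in> G" "c \<in> carrier K"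
        using xH by (auto simp: H_def)
      have g: "g \<in> carrier U"
        using x(2) G'(1) by blast
      have eq: "f g \<oplus>\<^bsub>W\<^esub> c \<odot>\<^bsub>W\<^esub> f a = \<zero>\<^bsub>W\<^esub>"
        using fx x g a(1) f by simp
      have "c = \<zero>\<^bsub>K\<^esub>"
      proof (rule ccontr)
        assume "c \<noteq> \<zero>\<^bsub>K\<^esub>"
        then have c: "inv\<^bsub>K\<^esub> c \<in> carrier K" "inv\<^bsub>K\<^esub> c \<otimes>\<^bsub>K\<^esub> c = \<one>\<^bsub>K\<^esub>"
          using x(3) K.field_Units by (auto intro: K.Units_l_inv)
        have "f a = inv\<^bsub>K\<^esub> c \<odot>\<^bsub>W\<^esub> (c \<odot>\<^bsub>W\<^esub> f a)"
          using c x(3) a(1) f(1) by (simp flip: W.smult_assoc1)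
        also have "c \<odot>\<^bsub>W\<^esub> f a = \<ominus>\<^bsub>W\<^esub> f g"
          using eq g a(1) x(3) f(1) by (metis W.M.add.inv_equality W.M.a_comm W.smult_closed)
        also have "inv\<^bsub>K\<^esub> c \<odot>\<^bsub>W\<^esub> (\<ominus>\<^bsub>W\<^esub> f g) = f (inv\<^bsub>K\<^esub> c \<odot>\<^bsub>U\<^esub> (\<ominus>\<^bsub>U\<^esub> g))"
          using c(1) g f linear_maps_minus[OF assms(2-4)] by simp
        finally show False
          using a(2) c(1) x(2) G'(3,4) by blast
      qed
      then have "x = g"
        using x a(1) g by simp
      then show ?thesis
        using ker x(2) fx by simp
    qed
    then have "H \<in> \<A>"
      using submodule_adjoin[OF assms(2) subG a(1)] by (simp add: \<A>_def H_def)
    moreover have "G \<subseteq> H"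
    proof
      fix g assume "g \<in> G"
      moreover from this have "g = g \<oplus>\<^bsub>U\<^esub> \<zero>\<^bsub>K\<^esub> \<odot>\<^bsub>U\<^esub> a"
        using G'(1) a(1) by auto
      ultimately show "g \<in> H"
        unfolding H_def by blast
    qed
    moreover have "a \<in> H"
    proof -
      have "a = \<zero>\<^bsub>U\<^esub> \<oplus>\<^bsub>U\<^esub> \<one>\<^bsub>K\<^esub> \<odot>\<^bsub>U\<^esub> a"
        using a(1) by simp
      then show ?thesis
        unfolding H_def using G0 by blast
    qed
    ultimately show False
      using G(2) a(2) by blast
  qed
  define s where "s = inv_into G f"
  have s: "s w \<in> G" "f (s w) = w" if "w \<in> carrier W" for w
    using that surj by (auto simp: s_def inv_into_into f_inv_into_f)
  have sU: "s w \<in> carrier U" if "w \<in> carrier W" for w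
    using s(1)[OF that] G'(1) by blast
  \<comment> \<open>\<open>G\<close> is closed under the operations, so both sides of each identity
    lie in \<open>G\<close>; they have the same image under \<open>f\<close>, which is injective
    there.\<close>
  have "s \<in> linear_maps K W U"
  proof (rule linear_mapsI)
    show "s w \<in> carrier U" if "w \<in> carrier W" for w
      by (rule sU[OF that])
    show "s (x \<oplus>\<^bsub>W\<^esub> y) = s x \<oplus>\<^bsub>U\<^esub> s y" if "x \<in> carrier W" "y \<in> carrier W" for x y
      by (rule inj_onD[OF inj]) (use that s sU f G'(5) in auto)
    show "s (a \<odot>\<^bsub>W\<^esub> x) = a \<odot>\<^bsub>U\<^esub> s x" if "a \<in> carrier K" "x \<in> carrier W" for a x
      by (rule inj_onD[OF inj]) (use that s sU f G'(4) in auto)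
  qed
  then show ?thesis
    using s(2) by (rule that)
qed

section \<open>Equivalence and transport of extensions\<close>

lemma trivial_algebra_simps [simp]:
  "carrier (trivial_algebra V) = carrier V"
  "add (trivial_algebra V) = add V"
  "zero (trivial_algebra V) = zero V"
  "smult (trivial_algebra V) = smult V"
  "x \<otimes>\<^bsub>trivial_algebra V\<^esub> y = \<zero>\<^bsub>V\<^esub>"
  by (simp_all add: trivial_algebra_def)

lemma module_trivial_algebra: "module K V \<Longrightarrow> module K (trivial_algebra V)"
  by (simp add: module_def abelian_group_def abelian_group_axioms_def abelian_monoid_def
      module_axioms_def trivial_algebra_def)

lemma linear_maps_trivial_algebra [simp]:
  "linear_maps K (trivial_algebra V) W = linear_maps K V W"
  "linear_maps K V (trivial_algebra W) = linear_maps K V W"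
  by (simp_all add: linear_maps_def)

lemma is_extensionD:
  assumes "is_extension K Q W (A, i, \<pi>)"
  shows "assoc_algebra K A" "field K" "module K A"
    and "i \<in> algebra_morphisms K W A" "\<pi> \<in> algebra_morphisms K A Q"
    and "i \<in> linear_maps K W A" "\<pi> \<in> linear_maps K A Q"
    and "inj_on i (carrier W)"
    and "i ` carrier W = {a \<in> carrier A. \<pi> a = \<zero>\<^bsub>Q\<^esub>}"
    and "\<pi> ` carrier A = carrier Q"
  using assms by (auto simp: is_extension_def algebra_morphisms_def assoc_algebra_def)

lemma equivalent_extensions_refl: "equivalent_extensions K W E E"
  by (cases E) (force simp: equivalent_extensions_def algebra_morphisms_def linear_maps_def
      intro!: bexI[of _ "\<lambda>x. x"])

lemma equivalent_extensions_trans: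
  assumes "equivalent_extensions K W E F" "equivalent_extensions K W F G"
  shows "equivalent_extensions K W E G"
proof -
  obtain A i \<pi> B j \<rho> C k \<sigma> where E: "E = (A, i, \<pi>)" "F = (B, j, \<rho>)" "G = (C, k, \<sigma>)"
    by (metis prod_cases3)
  obtain \<phi> \<psi> where
    "\<phi> \<in> algebra_morphisms K A B" "\<forall>x\<in>carrier W. \<phi> (i x) = j x" "\<forall>a\<in>carrier A. \<rho> (\<phi> a) = \<pi> a"
    "\<psi> \<in> algebra_morphisms K B C" "\<forall>x\<in>carrier W. \<psi> (j x) = k x" "\<forall>a\<in>carrier B. \<sigma> (\<psi> a) = \<rho> a"
    using assms by (auto simp: E equivalent_extensions_def)
  then show ?thesis
    unfolding E equivalent_extensions_def split_conv
    by (intro bexI[of _ "\<lambda>x. \<psi> (\<phi> x)"])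
      (auto simp: algebra_morphisms_def linear_maps_def Pi_def)
qed

text \<open>The short five lemma, proved by a diagram chase.\<close>

lemma equivalence_of_extensions_bij:
  assumes "module K Q" "module K W"
    and E: "is_extension K Q W (A, i, \<pi>)" and F: "is_extension K Q W (B, j, \<rho>)"
    and \<phi>: "\<phi> \<in> linear_maps K A B"
    and \<phi>i: "\<And>x. x \<in> carrier W \<Longrightarrow> \<phi> (i x) = j x"
    and \<phi>\<pi>: "\<And>a. a \<in> carrier A \<Longrightarrow> \<rho> (\<phi> a) = \<pi> a"
  shows "bij_betw \<phi> (carrier A) (carrier B)"
proof -
  interpret W: module K W by fact
  interpret Q: module K Q by fact
  interpret A: module K A by (rule is_extensionD(3)[OF E])
  interpret B: module K B by (rule is_extensionD(3)[OF F])
  note E = is_extensionD[OF E] and F = is_extensionD[OF F]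
  note i = linear_mapsD[OF E(6)] and j = linear_mapsD[OF F(6)]
  note \<rho> = linear_mapsD[OF F(7)] and \<phi>_lin = linear_mapsD[OF \<phi>]
  note zero = linear_maps_zero[OF assms(2) E(3,6)] linear_maps_zero[OF assms(2) F(3,6)]
    linear_maps_zero[OF F(3) assms(1) F(7)]
  have "inj_on \<phi> (carrier A)"
  proof (rule linear_maps_injI[OF E(3) F(3) \<phi>])
    show "submodule (carrier A) K A"
      by (rule A.submoduleI) auto
    \<comment> \<open>Since \<pi> a = \<rho> (\<phi> a) = 0, exactness gives a = i x; then j x =
      \<phi> (i x) = 0 forces x = 0.\<close>
    fix a assume a: "a \<in> carrier A" "\<phi> a = \<zero>\<^bsub>B\<^esub>"
    then have "\<pi> a = \<zero>\<^bsub>Q\<^esub>"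
      using \<phi>\<pi> zero(3) by metis
    then obtain x where x: "x \<in> carrier W" "a = i x"
      using E(9) a(1) by blast
    then have "j x = j \<zero>\<^bsub>W\<^esub>"
      using a(2) \<phi>i zero(2) by simp
    then have "x = \<zero>\<^bsub>W\<^esub>"
      using inj_onD[OF F(8)] x(1) by simp
    then show "a = \<zero>\<^bsub>A\<^esub>"
      using x(2) zero(1) by simp
  qed
  moreover have "carrier B \<subseteq> \<phi> ` carrier A"
  proof
    \<comment> \<open>Some \<open>a\<close> in \<open>A\<close> has the same image in
      \<open>Q\<close> as \<open>b\<close>. The difference b - \<phi> a lies in the kernel of
      \<rho>, hence equals some j x, and b = \<phi> (i x + a).\<close>
    fix b assume b: "b \<in> carrier B"
    then obtain a where a: "a \<in> carrier A" "\<rho> b = \<pi> a"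
      using E(10) \<rho>(1) by (metis imageE)
    have "\<rho> (b \<oplus>\<^bsub>B\<^esub> \<ominus>\<^bsub>B\<^esub> \<phi> a) = \<zero>\<^bsub>Q\<^esub>"
      using a b \<rho> \<phi>_lin(1) \<phi>\<pi> linear_maps_minus[OF F(3) assms(1) F(7)]
      by (metis B.M.a_inv_closed Q.M.r_neg)
    then have "b \<oplus>\<^bsub>B\<^esub> \<ominus>\<^bsub>B\<^esub> \<phi> a \<in> j ` carrier W"
      using F(9) a(1) b \<phi>_lin(1) by simp
    then obtain x where x: "x \<in> carrier W" "b \<oplus>\<^bsub>B\<^esub> \<ominus>\<^bsub>B\<^esub> \<phi> a = j x"
      by blast
    have "b = b \<oplus>\<^bsub>B\<^esub> \<ominus>\<^bsub>B\<^esub> \<phi> a \<oplus>\<^bsub>B\<^esub> \<phi> a"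
      using b a(1) \<phi>_lin(1) by (simp add: B.M.a_assoc B.M.l_neg)
    also have "\<dots> = \<phi> (i x \<oplus>\<^bsub>A\<^esub> a)"
      using x a(1) i(1) \<phi>_lin(2) \<phi>i by simp
    finally show "b \<in> \<phi> ` carrier A"
      using x a(1) i(1) by blast
  qed
  ultimately show ?thesis
    using \<phi>_lin(1) by (auto simp: bij_betw_def)
qed

text \<open>The definition asks for a morphism in one direction only. By the five lemma it is
  bijective, and its inverse is again a morphism compatible with the structure maps.\<close>

lemma equivalent_extensions_sym:
  assumes "module K Q" "module K W" "is_extension K Q W E" "is_extension K Q W F"
    and "equivalent_extensions K W E F"
  shows "equivalent_extensions K W F E"
proof -
  obtain A i \<pi> B j \<rho> where EF: "E = (A, i, \<pi>)" "F = (B, j, \<rho>)"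
    by (metis prod_cases3)
  note E = assms(3)[unfolded EF] and F = assms(4)[unfolded EF]
  obtain \<phi> where \<phi>: "\<phi> \<in> linear_maps K A B"
    "\<And>x y. \<lbrakk>x \<in> carrier A; y \<in> carrier A\<rbrakk> \<Longrightarrow> \<phi> (x \<otimes>\<^bsub>A\<^esub> y) = \<phi> x \<otimes>\<^bsub>B\<^esub> \<phi> y"
    "\<And>x. x \<in> carrier W \<Longrightarrow> \<phi> (i x) = j x" "\<And>a. a \<in> carrier A \<Longrightarrow> \<rho> (\<phi> a) = \<pi> a"
    using assms(5) by (auto simp: EF equivalent_extensions_def algebra_morphisms_def)
  interpret A: assoc_algebra K A by (rule is_extensionD(1)[OF E])
  interpret B: assoc_algebra K B by (rule is_extensionD(1)[OF F])
  note l = linear_mapsD[OF \<phi>(1)]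
  have "bij_betw \<phi> (carrier A) (carrier B)"
    using equivalence_of_extensions_bij[OF assms(1,2) E F \<phi>(1,3,4)] by blast
  then have inj: "inj_on \<phi> (carrier A)" and surj: "\<phi> ` carrier A = carrier B"
    by (auto simp: bij_betw_def)
  define \<psi> where "\<psi> = inv_into (carrier A) \<phi>"
  have \<psi>: "\<psi> b \<in> carrier A" "\<phi> (\<psi> b) = b" if "b \<in> carrier B" for b
    using that surj by (auto simp: \<psi>_def inv_into_into f_inv_into_f)
  \<comment> \<open>Reduces each identity for \<psi> to one for \<phi>: it suffices that \<phi>
    sends the claimed value to the argument of \<psi>.\<close>
  have eq: "\<psi> b = a" if "a \<in> carrier A" "\<phi> a = b" for a b
    using that inj by (auto simp: \<psi>_def)
  have "\<psi> \<in> algebra_morphisms K B A"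
    unfolding algebra_morphisms_def mem_Collect_eq
  proof (intro conjI ballI linear_mapsI)
  qed (auto intro!: eq simp: \<psi> l \<phi>(2) A.mult_closed)
  moreover have "\<psi> (j x) = i x" if "x \<in> carrier W" for x
    using that \<phi>(3) linear_mapsD(1)[OF is_extensionD(6)[OF E]] by (auto intro: eq)
  moreover have "\<pi> (\<psi> b) = \<rho> b" if "b \<in> carrier B" for b
    using \<psi>[OF that] \<phi>(4) by metis
  ultimately show ?thesis
    by (auto simp: EF equivalent_extensions_def)
qed

text \<open>Transport of structure along \<open>h\<close>, with \<open>h\<close> itself as the
  equivalence. It replaces an extension by an equivalent one whose underlying set lies in a
  prescribed type.\<close>

lemma extension_transport:
  fixes h :: "'a \<Rightarrow> 'u"
  assumes E: "is_extension K Q W (A, i, \<pi>)" and inj: "inj_on h (carrier A)"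
  obtains F :: "('k, 'w, 'u, 'q) extension"
  where "is_extension K Q W F" "equivalent_extensions K W (A, i, \<pi>) F"
proof -
  interpret A: assoc_algebra K A by (rule is_extensionD(1)[OF E])
  define g where "g = inv_into (carrier A) h"
  have g: "g (h a) = a" if "a \<in> carrier A" for a
    using that inj by (simp add: g_def)
  \<comment> \<open>Each operation pulls its arguments in \<open>B\<close> back by \<open>g\<close>,
    computes in \<open>A\<close>, and pushes the result forward by \<open>h\<close>; the algebra
    laws then reduce to those of \<open>A\<close>.\<close>
  define B :: "('k, 'u) module" where
    "B = \<lparr>carrier = h ` carrier A, mult = \<lambda>x y. h (g x \<otimes>\<^bsub>A\<^esub> g y), one = undefined,
          zero = h \<zero>\<^bsub>A\<^esub>, add = \<lambda>x y. h (g x \<oplus>\<^bsub>A\<^esub> g y), smult = \<lambda>a x. h (a \<odot>\<^bsub>A\<^esub> g x)\<rparr>"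
  have "abelian_group B"
  proof (rule abelian_groupI)
    fix x assume "x \<in> carrier B"
    then obtain a where "a \<in> carrier A" "x = h a"
      by (auto simp: B_def)
    then show "\<exists>y\<in>carrier B. y \<oplus>\<^bsub>B\<^esub> x = \<zero>\<^bsub>B\<^esub>"
      by (intro bexI[of _ "h (\<ominus>\<^bsub>A\<^esub> a)"]) (auto simp: B_def g A.M.l_neg)
  qed (auto simp: B_def g A.M.a_assoc A.M.a_comm A.M.a_lcomm)
  then have "module K B"
    by (intro moduleI module.axioms(1)[OF is_extensionD(3)[OF E]])
      (auto simp: B_def g A.smult_l_distr A.smult_r_distr A.smult_assoc1)
  then have "assoc_algebra K B"
    by (intro assoc_algebra.intro assoc_algebra_axioms.intro A.field_axioms)
      (auto simp: B_def g A.mult_closed A.mult_assoc A.mult_add_left A.mult_add_right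
        A.mult_smult_left A.mult_smult_right)
  note E' = is_extensionD[OF E]
  note i = linear_mapsD[OF E'(6)] and \<pi> = linear_mapsD[OF E'(7)]
  have "is_extension K Q W (B, \<lambda>x. h (i x), \<lambda>b. \<pi> (g b))"
    unfolding is_extension_def split_conv
  proof (intro conjI)
    show "assoc_algebra K B" by fact
    show "(\<lambda>x. h (i x)) \<in> algebra_morphisms K W B"
      using E'(4) by (auto simp: algebra_morphisms_def linear_maps_def B_def g Pi_def)
    show "(\<lambda>b. \<pi> (g b)) \<in> algebra_morphisms K B Q"
      using E'(5) by (auto simp: algebra_morphisms_def linear_maps_def B_def g Pi_def A.mult_closed)
    show "inj_on (\<lambda>x. h (i x)) (carrier W)"
      using E'(8) inj i(1) by (auto simp: inj_on_def)
    have "(\<lambda>x. h (i x)) ` carrier W = h ` {a \<in> carrier A. \<pi> a = \<zero>\<^bsub>Q\<^esub>}"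
      by (simp flip: E'(9) add: image_image)
    then show "(\<lambda>x. h (i x)) ` carrier W = {b \<in> carrier B. \<pi> (g b) = \<zero>\<^bsub>Q\<^esub>}"
      by (auto simp: B_def g)
    show "(\<lambda>b. \<pi> (g b)) ` carrier B = carrier Q"
      by (simp flip: E'(10) add: B_def image_image g cong: image_cong)
  qed
  moreover have "equivalent_extensions K W (A, i, \<pi>) (B, \<lambda>x. h (i x), \<lambda>b. \<pi> (g b))"
    unfolding equivalent_extensions_def split_conv
    by (rule bexI[of _ h]) (auto simp: algebra_morphisms_def linear_maps_def B_def g)
  ultimately show ?thesis
    by (rule that)
qed

text \<open>Within a single type \<open>extension_class\<close> is the usual quotient class. In this
  form the classes can be compared with those of extensions whose underlying sets lie in another
  type.\<close>

lemma Ext_eq: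
  "(Ext K Q W :: ('k, 'w, 'a, 'q) extension set set) =
    extension_class K Q W ` {E :: ('k, 'w, 'a, 'q) extension. is_extension K Q W E}"
proof -
  let ?R = "{(E, F :: ('k, 'w, 'a, 'q) extension).
    is_extension K Q W E \<and> is_extension K Q W F \<and> equivalent_extensions K W E F}"
  have "?R `` {E} = extension_class K Q W E" if "is_extension K Q W E" for E
    using that by (auto simp: extension_class_def)
  then show ?thesis
    unfolding Ext_def quotient_def UNION_singleton_eq_range by (intro image_cong) auto
qed

lemma extension_class_eqI:
  assumes "module K Q" "module K W" "is_extension K Q W E" "is_extension K Q W F"
    and "equivalent_extensions K W E F"
  shows "extension_class K Q W E = extension_class K Q W F"
  using equivalent_extensions_trans[OF assms(5)]
    equivalent_extensions_trans[OF equivalent_extensions_sym[OF assms]]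
  by (auto simp: extension_class_def)

text \<open>A common member \<open>G\<close> links \<open>E\<close> to \<open>F\<close>. Equality of
  the two classes alone would not suffice, since both might be empty in the chosen type.\<close>

lemma equivalent_extensionsI:
  assumes "module K Q" "module K W" "is_extension K Q W E" "is_extension K Q W F"
    and "G \<in> extension_class K Q W E" "G \<in> extension_class K Q W F"
  shows "equivalent_extensions K W E F"
proof -
  have "is_extension K Q W G" "equivalent_extensions K W E G" "equivalent_extensions K W F G"
    using assms(5,6) by (simp_all add: extension_class_def)
  then show ?thesis
    using equivalent_extensions_trans equivalent_extensions_sym assms(1-4) by metis
qed

section \<open>Metabelian products\<close>

lemma bilinear_mapsD:
  assumes "f \<in> bilinear_maps K U V W"
  shows "\<lbrakk>x \<in> carrier U; y \<in> carrier V\<rbrakk> \<Longrightarrow> f (x, y) \<in> carrier W"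
    and "\<lbrakk>x \<in> carrier U; x' \<in> carrier U; y \<in> carrier V\<rbrakk>
      \<Longrightarrow> f (x \<oplus>\<^bsub>U\<^esub> x', y) = f (x, y) \<oplus>\<^bsub>W\<^esub> f (x', y)"
    and "\<lbrakk>x \<in> carrier U; y \<in> carrier V; y' \<in> carrier V\<rbrakk>
      \<Longrightarrow> f (x, y \<oplus>\<^bsub>V\<^esub> y') = f (x, y) \<oplus>\<^bsub>W\<^esub> f (x, y')"
    and "\<lbrakk>a \<in> carrier K; x \<in> carrier U; y \<in> carrier V\<rbrakk> \<Longrightarrow> f (a \<odot>\<^bsub>U\<^esub> x, y) = a \<odot>\<^bsub>W\<^esub> f (x, y)"
    and "\<lbrakk>a \<in> carrier K; x \<in> carrier U; y \<in> carrier V\<rbrakk> \<Longrightarrow> f (x, a \<odot>\<^bsub>V\<^esub> y) = a \<odot>\<^bsub>W\<^esub> f (x, y)"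
  using assms by (auto simp: bilinear_maps_def linear_maps_def)

lemma bilinear_maps_zero:
  assumes "module K U" "module K V" "module K W" "f \<in> bilinear_maps K U V W"
  shows "y \<in> carrier V \<Longrightarrow> f (\<zero>\<^bsub>U\<^esub>, y) = \<zero>\<^bsub>W\<^esub>"
    and "x \<in> carrier U \<Longrightarrow> f (x, \<zero>\<^bsub>V\<^esub>) = \<zero>\<^bsub>W\<^esub>"
  using assms(4) linear_maps_zero[OF assms(1,3), of "\<lambda>x. f (x, y)"]
    linear_maps_zero[OF assms(2,3), of "\<lambda>y. f (x, y)"]
  by (auto simp: bilinear_maps_def)

lemma bilinear_maps_eqI:
  assumes "f \<in> bilinear_maps K U V W" "g \<in> bilinear_maps K U V W"
    and "\<And>x y. \<lbrakk>x \<in> carrier U; y \<in> carrier V\<rbrakk> \<Longrightarrow> f (x, y) = g (x, y)"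
  shows "f = g"
  using assms by (intro PiE_ext[of f "carrier U \<times> carrier V" "\<lambda>_. carrier W"])
    (auto simp: bilinear_maps_def)

text \<open>Turns a bilinear function into the extensional form demanded by
  \<open>bilinear_maps\<close>. The module hypotheses ensure that sums and multiples stay in the
  carriers, where the restriction agrees with \<open>f\<close>.\<close>

lemma bilinear_maps_restrictI:
  assumes "\<And>x y. \<lbrakk>x \<in> carrier U; y \<in> carrier V\<rbrakk> \<Longrightarrow> f x y \<in> carrier W"
    and "\<And>x x' y. \<lbrakk>x \<in> carrier U; x' \<in> carrier U; y \<in> carrier V\<rbrakk>
      \<Longrightarrow> f (x \<oplus>\<^bsub>U\<^esub> x') y = f x y \<oplus>\<^bsub>W\<^esub> f x' y"
    and "\<And>x y y'. \<lbrakk>x \<in> carrier U; y \<in> carrier V; y' \<in> carrier V\<rbrakk>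
      \<Longrightarrow> f x (y \<oplus>\<^bsub>V\<^esub> y') = f x y \<oplus>\<^bsub>W\<^esub> f x y'"
    and "\<And>a x y. \<lbrakk>a \<in> carrier K; x \<in> carrier U; y \<in> carrier V\<rbrakk>
      \<Longrightarrow> f (a \<odot>\<^bsub>U\<^esub> x) y = a \<odot>\<^bsub>W\<^esub> f x y"
    and "\<And>a x y. \<lbrakk>a \<in> carrier K; x \<in> carrier U; y \<in> carrier V\<rbrakk>
      \<Longrightarrow> f x (a \<odot>\<^bsub>V\<^esub> y) = a \<odot>\<^bsub>W\<^esub> f x y"
    and "module K U" "module K V"
  shows "restrict (\<lambda>(x, y). f x y) (carrier U \<times> carrier V) \<in> bilinear_maps K U V W"
proof -
  interpret U: module K U by fact
  interpret V: module K V by fact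
  show ?thesis
    unfolding bilinear_maps_def mem_Collect_eq
    by (intro conjI ballI linear_mapsI) (auto simp: assms)
qed

lemma discrete_bimodulesD:
  assumes "(l, r) \<in> discrete_bimodules K P V"
  shows "l \<in> bilinear_maps K V P V" "r \<in> bilinear_maps K P V V"
    and "\<lbrakk>p \<in> carrier P; q \<in> carrier P; x \<in> carrier V\<rbrakk> \<Longrightarrow> l (l (x, p), q) = \<zero>\<^bsub>V\<^esub>"
    and "\<lbrakk>p \<in> carrier P; q \<in> carrier P; x \<in> carrier V\<rbrakk> \<Longrightarrow> r (p, r (q, x)) = \<zero>\<^bsub>V\<^esub>"
    and "\<lbrakk>p \<in> carrier P; q \<in> carrier P; x \<in> carrier V\<rbrakk> \<Longrightarrow> r (p, l (x, q)) = l (r (p, x), q)"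
  using assms by (auto simp: discrete_bimodules_def)

lemma DZ2D:
  assumes "\<theta> \<in> DZ2 K P V (l, r)"
  shows "\<theta> \<in> bilinear_maps K P P V"
    and "\<lbrakk>p \<in> carrier P; q \<in> carrier P; s \<in> carrier P\<rbrakk> \<Longrightarrow> r (p, \<theta> (q, s)) = l (\<theta> (p, q), s)"
  using assms by (auto simp: DZ2_def)

lemma metabelian_product_simps [simp]:
  "carrier (metabelian_product P V b \<theta>) = carrier P \<times> carrier V"
  "\<zero>\<^bsub>metabelian_product P V b \<theta>\<^esub> = (\<zero>\<^bsub>P\<^esub>, \<zero>\<^bsub>V\<^esub>)"
  "(p, x) \<oplus>\<^bsub>metabelian_product P V b \<theta>\<^esub> (q, y) = (p \<oplus>\<^bsub>P\<^esub> q, x \<oplus>\<^bsub>V\<^esub> y)"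
  "a \<odot>\<^bsub>metabelian_product P V b \<theta>\<^esub> (p, x) = (a \<odot>\<^bsub>P\<^esub> p, a \<odot>\<^bsub>V\<^esub> x)"
  "(p, x) \<otimes>\<^bsub>metabelian_product P V (l, r) \<theta>\<^esub> (q, y) =
    (\<zero>\<^bsub>P\<^esub>, \<theta> (p, q) \<oplus>\<^bsub>V\<^esub> r (p, y) \<oplus>\<^bsub>V\<^esub> l (x, q))"
  by (simp_all add: metabelian_product_def split: prod.split)

lemma module_metabelian_product:
  assumes "module K P" "module K V"
  shows "module K (metabelian_product P V b \<theta>)"
proof -
  interpret P: module K P by fact
  interpret V: module K V by fact
  have "abelian_group (metabelian_product P V b \<theta>)"
  proof (rule abelian_groupI)
    fix u assume "u \<in> carrier (metabelian_product P V b \<theta>)"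
    then show "\<exists>v\<in>carrier (metabelian_product P V b \<theta>).
        v \<oplus>\<^bsub>metabelian_product P V b \<theta>\<^esub> u = \<zero>\<^bsub>metabelian_product P V b \<theta>\<^esub>"
      by (cases u) (auto simp: P.M.l_neg V.M.l_neg
          intro!: bexI[of _ "(\<ominus>\<^bsub>P\<^esub> fst u, \<ominus>\<^bsub>V\<^esub> snd u)"])
  qed (auto simp: P.M.a_assoc V.M.a_assoc P.M.a_comm V.M.a_comm P.M.a_lcomm V.M.a_lcomm)
  then show ?thesis
    by (intro moduleI module.axioms(1)[OF assms(1)])
      (auto simp: P.smult_l_distr P.smult_r_distr P.smult_assoc1
        V.smult_l_distr V.smult_r_distr V.smult_assoc1)
qed

text \<open>For associativity, the two bracketings of (p, x), (q, y), (s, z) have second components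
  l (\<theta> (p, q) + r (p, y) + x', s), with x' = l (x, q), and r (p, \<theta> (q, s) + r (q, z) +
  l (y, s)). The cocycle identity matches the \<theta> terms, the mixed bimodule axiom matches the
  terms in y, and the terms in x and z vanish.\<close>

lemma is_extension_metabelian:
  assumes "field K" "module K P" "module K V"
    and b: "b \<in> discrete_bimodules K P V" and \<theta>: "\<theta> \<in> DZ2 K P V b"
  shows "is_extension K (trivial_algebra P) (trivial_algebra V) (metabelian_extension P V b \<theta>)"
proof -
  interpret P: module K P by fact
  interpret V: module K V by fact
  obtain l r where lr: "b = (l, r)"
    by (cases b)
  note D = discrete_bimodulesD[OF b[unfolded lr]] and Z = DZ2D[OF \<theta>[unfolded lr]]
  note bil = bilinear_mapsD[OF D(1)] bilinear_mapsD[OF D(2)] bilinear_mapsD[OF Z(1)]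
  note zero = bilinear_maps_zero[OF assms(3,2,3) D(1)] bilinear_maps_zero[OF assms(2,3,3) D(2)]
    bilinear_maps_zero[OF assms(2,2,3) Z(1)]
  let ?M = "metabelian_product P V b \<theta>"
  have "assoc_algebra K ?M"
    by (intro assoc_algebra.intro assoc_algebra_axioms.intro assms(1)
        module_metabelian_product[OF assms(2,3)])
      (auto simp: lr bil zero D(3-5) Z(2) V.smult_r_distr V.M.a_ac)
  moreover have "(\<lambda>x. (\<zero>\<^bsub>P\<^esub>, x)) \<in> algebra_morphisms K (trivial_algebra V) ?M"
    by (auto simp: algebra_morphisms_def linear_maps_def lr zero)
  moreover have "(\<lambda>(p, x). p) \<in> algebra_morphisms K ?M (trivial_algebra P)"
    by (auto simp: algebra_morphisms_def linear_maps_def lr)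
  ultimately show ?thesis
    unfolding is_extension_def metabelian_extension_def split_conv
    by (force simp: inj_on_def)
qed

text \<open>
  A morphism compatible with the injections of \<open>V\<close> and the projections onto \<open>P\<close> has the form
  \<open>(p, x) \<mapsto> (p, f p + x)\<close> with \<open>f\<close> linear. It is multiplicative iff the bimodule structures
  agree and the cocycles differ by the coboundary of \<open>f\<close>.
\<close>

lemma metabelian_equivalent_iff:
  assumes "module K P" "module K V"
    and b: "b \<in> discrete_bimodules K P V" and \<theta>: "\<theta> \<in> DZ2 K P V b"
    and b': "b' \<in> discrete_bimodules K P V" and \<theta>': "\<theta>' \<in> DZ2 K P V b'"
  shows "equivalent_extensions K (trivial_algebra V)
      (metabelian_extension P V b \<theta>) (metabelian_extension P V b' \<theta>')
    \<longleftrightarrow> b = b' \<and> (\<theta>, \<theta>') \<in> cohomologous K P V b" (is "?equiv \<longleftrightarrow> ?coh")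
proof -
  interpret P: module K P by fact
  interpret V: module K V by fact
  obtain l r l' r' where lr: "b = (l, r)" "b' = (l', r')"
    by (metis surj_pair)
  note D = discrete_bimodulesD[OF b[unfolded lr]] and Z = DZ2D[OF \<theta>[unfolded lr]]
  note D' = discrete_bimodulesD[OF b'[unfolded lr]] and Z' = DZ2D[OF \<theta>'[unfolded lr]]
  note bil = bilinear_mapsD[OF D(1)] bilinear_mapsD[OF D(2)] bilinear_mapsD[OF Z(1)]
    bilinear_mapsD[OF D'(1)] bilinear_mapsD[OF D'(2)] bilinear_mapsD[OF Z'(1)]
  note zero = bilinear_maps_zero[OF assms(2,1,2) D(1)] bilinear_maps_zero[OF assms(1,2,2) D(2)]
    bilinear_maps_zero[OF assms(1,1,2) Z(1)]
    bilinear_maps_zero[OF assms(2,1,2) D'(1)] bilinear_maps_zero[OF assms(1,2,2) D'(2)]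
    bilinear_maps_zero[OF assms(1,1,2) Z'(1)]
  let ?M = "metabelian_product P V b \<theta>" and ?M' = "metabelian_product P V b' \<theta>'"
  show ?thesis
  proof
    assume ?equiv
    then obtain \<phi> where \<phi>: "\<phi> \<in> linear_maps K ?M ?M'"
      "\<And>u v. \<lbrakk>u \<in> carrier ?M; v \<in> carrier ?M\<rbrakk> \<Longrightarrow> \<phi> (u \<otimes>\<^bsub>?M\<^esub> v) = \<phi> u \<otimes>\<^bsub>?M'\<^esub> \<phi> v"
      "\<And>x. x \<in> carrier V \<Longrightarrow> \<phi> (\<zero>\<^bsub>P\<^esub>, x) = (\<zero>\<^bsub>P\<^esub>, x)"
      "\<And>u. u \<in> carrier ?M \<Longrightarrow> fst (\<phi> u) = fst u"
      by (auto simp: equivalent_extensions_def metabelian_extension_def algebra_morphisms_def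
          case_prod_beta)
    note lin = linear_mapsD[OF \<phi>(1)]
    \<comment> \<open>The \<theta>-independent splitting p |-> (p, 0) is linear though generally not
      multiplicative; \<open>f\<close> measures how far \<phi> moves it.\<close>
    define f where "f p = snd (\<phi> (p, \<zero>\<^bsub>V\<^esub>))" for p
    have \<phi>0: "\<phi> (p, \<zero>\<^bsub>V\<^esub>) = (p, f p)" if "p \<in> carrier P" for p
      using \<phi>(4)[of "(p, \<zero>\<^bsub>V\<^esub>)"] that by (simp add: f_def prod_eq_iff)
    have f: "f \<in> linear_maps K P V"
    proof (rule linear_mapsI)
      show "f p \<in> carrier V" if "p \<in> carrier P" for p
        using lin(1)[of "(p, \<zero>\<^bsub>V\<^esub>)"] \<phi>0 that by simp
      show "f (p \<oplus>\<^bsub>P\<^esub> q) = f p \<oplus>\<^bsub>V\<^esub> f q" if "p \<in> carrier P" "q \<in> carrier P" for p q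
        using lin(2)[of "(p, \<zero>\<^bsub>V\<^esub>)" "(q, \<zero>\<^bsub>V\<^esub>)"] \<phi>0 that by simp
      show "f (a \<odot>\<^bsub>P\<^esub> p) = a \<odot>\<^bsub>V\<^esub> f p" if "a \<in> carrier K" "p \<in> carrier P" for a p
        using lin(3)[of a "(p, \<zero>\<^bsub>V\<^esub>)"] \<phi>0 that by simp
    qed
    note fD = linear_mapsD[OF f]
    have \<phi>_eq: "\<phi> (p, x) = (p, f p \<oplus>\<^bsub>V\<^esub> x)" if "p \<in> carrier P" "x \<in> carrier V" for p x
      using lin(2)[of "(p, \<zero>\<^bsub>V\<^esub>)" "(\<zero>\<^bsub>P\<^esub>, x)"] \<phi>0 \<phi>(3) that by simp
    have f0: "f \<zero>\<^bsub>P\<^esub> = \<zero>\<^bsub>V\<^esub>"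
      by (rule linear_maps_zero[OF assms(1,2) f])
    \<comment> \<open>Second components of multiplicativity at (p, x) and (q, y). The choices p = y
      = 0, q = x = 0 and x = y = 0 isolate \<open>l\<close>, \<open>r\<close> and the cocycles
      respectively.\<close>
    have key: "\<theta> (p, q) \<oplus>\<^bsub>V\<^esub> r (p, y) \<oplus>\<^bsub>V\<^esub> l (x, q) =
        \<theta>' (p, q) \<oplus>\<^bsub>V\<^esub> r' (p, f q \<oplus>\<^bsub>V\<^esub> y) \<oplus>\<^bsub>V\<^esub> l' (f p \<oplus>\<^bsub>V\<^esub> x, q)"
      if "p \<in> carrier P" "q \<in> carrier P" "x \<in> carrier V" "y \<in> carrier V" for p q x y
      using \<phi>(2)[of "(p, x)" "(q, y)"] that by (simp add: lr \<phi>_eq f0 bil fD)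
    have "l = l'"
    proof (rule bilinear_maps_eqI[OF D(1) D'(1)])
      show "l (x, q) = l' (x, q)" if "x \<in> carrier V" "q \<in> carrier P" for x q
        using key[of "\<zero>\<^bsub>P\<^esub>" q x "\<zero>\<^bsub>V\<^esub>"] that by (simp add: zero f0 bil fD)
    qed
    moreover have "r = r'"
    proof (rule bilinear_maps_eqI[OF D(2) D'(2)])
      show "r (p, y) = r' (p, y)" if "p \<in> carrier P" "y \<in> carrier V" for p y
        using key[of p "\<zero>\<^bsub>P\<^esub>" "\<zero>\<^bsub>V\<^esub>" y] that by (simp add: zero f0 bil fD)
    qed
    moreover have "\<theta> (p, q) = \<theta>' (p, q) \<oplus>\<^bsub>V\<^esub> r' (p, f q) \<oplus>\<^bsub>V\<^esub> l' (f p, q)"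
      if "p \<in> carrier P" "q \<in> carrier P" for p q
      using key[of p q "\<zero>\<^bsub>V\<^esub>" "\<zero>\<^bsub>V\<^esub>"] that by (simp add: zero bil fD)
    ultimately show ?coh
      using f \<theta> \<theta>' by (auto simp: lr cohomologous_def)
  next
    assume ?coh
    then obtain f where eq: "l' = l" "r' = r" and f: "f \<in> linear_maps K P V"
      and \<theta>_eq: "\<And>p q. \<lbrakk>p \<in> carrier P; q \<in> carrier P\<rbrakk>
        \<Longrightarrow> \<theta> (p, q) = \<theta>' (p, q) \<oplus>\<^bsub>V\<^esub> r (p, f q) \<oplus>\<^bsub>V\<^esub> l (f p, q)"
      by (auto simp: lr cohomologous_def)
    note fD = linear_mapsD[OF f] and f0 = linear_maps_zero[OF assms(1,2) f]
    \<comment> \<open>The cross terms r (p, f q) and l (f p, q) in the product of two images are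
      exactly the coboundary by which \<theta> exceeds \<theta>'.\<close>
    have "(\<lambda>(p, x). (p, f p \<oplus>\<^bsub>V\<^esub> x)) \<in> algebra_morphisms K ?M ?M'"
      by (auto simp: algebra_morphisms_def linear_maps_def lr eq bil fD f0 \<theta>_eq
          V.smult_r_distr V.M.a_ac)
    then show ?equiv
      unfolding equivalent_extensions_def metabelian_extension_def split_conv
      by (rule bexI[rotated]) (auto simp: f0)
  qed
qed

section \<open>Classification\<close>

lemma extension_equivalent_metabelian:
  assumes "module K P" "module K V"
    and E: "is_extension K (trivial_algebra P) (trivial_algebra V) (A, i, \<pi>)"
  obtains b \<theta> where "b \<in> discrete_bimodules K P V" "\<theta> \<in> DZ2 K P V b"
    "equivalent_extensions K (trivial_algebra V) (metabelian_extension P V b \<theta>) (A, i, \<pi>)"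
proof -
  interpret P: module K P by fact
  interpret V: module K V by fact
  interpret A: assoc_algebra K A by (rule is_extensionD(1)[OF E])
  note E' = is_extensionD[OF E, simplified]
  note i = linear_mapsD[OF E'(6)] and \<pi> = linear_mapsD[OF E'(7)]
  have i0: "i \<zero>\<^bsub>V\<^esub> = \<zero>\<^bsub>A\<^esub>"
    by (rule linear_maps_zero[OF assms(2) E'(3,6)])
  have i_mult: "i x \<otimes>\<^bsub>A\<^esub> i y = \<zero>\<^bsub>A\<^esub>" if "x \<in> carrier V" "y \<in> carrier V" for x y
  proof -
    have "\<forall>x\<in>carrier V. \<forall>y\<in>carrier V. i \<zero>\<^bsub>V\<^esub> = i x \<otimes>\<^bsub>A\<^esub> i y"
      using E'(4) unfolding algebra_morphisms_def trivial_algebra_simps by blast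
    then show ?thesis
      using that i0 by metis
  qed
  \<comment> \<open>Multiplication in the quotient is trivial, so every product of \<open>A\<close>
    lies in the kernel of \<pi>, that is, in the image of \<open>i\<close>. This lets
    \<open>j\<close> be applied to products below.\<close>
  have \<pi>_mult: "\<pi> (a \<otimes>\<^bsub>A\<^esub> c) = \<zero>\<^bsub>P\<^esub>" if "a \<in> carrier A" "c \<in> carrier A" for a c
    using E'(5) that by (simp add: algebra_morphisms_def)
  obtain s where s_lin: "s \<in> linear_maps K P A" and \<pi>s: "\<And>p. p \<in> carrier P \<Longrightarrow> \<pi> (s p) = p"
    using linear_section_exists[OF E'(2,3) assms(1) E'(7,10)] by blast
  note s = linear_mapsD[OF s_lin]
  define j where "j = inv_into (carrier V) i"
  have j: "j a \<in> carrier V" "i (j a) = a" if "a \<in> carrier A" "\<pi> a = \<zero>\<^bsub>P\<^esub>" for a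
  proof -
    have "a \<in> i ` carrier V"
      using that by (simp add: E'(9))
    then show "j a \<in> carrier V" "i (j a) = a"
      by (auto simp: j_def inv_into_into f_inv_into_f)
  qed
  \<comment> \<open>Identities in \<open>V\<close> are checked after applying the injective
    \<open>i\<close>, where they become identities between products in \<open>A\<close>.\<close>
  note i_eqI = inj_onD[OF E'(8)]
  define l where "l = restrict (\<lambda>(x, p). j (i x \<otimes>\<^bsub>A\<^esub> s p)) (carrier V \<times> carrier P)"
  define r where "r = restrict (\<lambda>(p, x). j (s p \<otimes>\<^bsub>A\<^esub> i x)) (carrier P \<times> carrier V)"
  define \<theta> where "\<theta> = restrict (\<lambda>(p, q). j (s p \<otimes>\<^bsub>A\<^esub> s q)) (carrier P \<times> carrier P)"
  note mult_simps = A.mult_closed A.mult_add_left A.mult_add_right A.mult_smult_left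
    A.mult_smult_right
  have il: "l (x, p) \<in> carrier V" "i (l (x, p)) = i x \<otimes>\<^bsub>A\<^esub> s p"
    if "x \<in> carrier V" "p \<in> carrier P" for x p
    using that by (simp_all add: l_def j i(1) s(1) \<pi>_mult A.mult_closed)
  have ir: "r (p, x) \<in> carrier V" "i (r (p, x)) = s p \<otimes>\<^bsub>A\<^esub> i x"
    if "x \<in> carrier V" "p \<in> carrier P" for x p
    using that by (simp_all add: r_def j i(1) s(1) \<pi>_mult A.mult_closed)
  have i\<theta>: "\<theta> (p, q) \<in> carrier V" "i (\<theta> (p, q)) = s p \<otimes>\<^bsub>A\<^esub> s q"
    if "p \<in> carrier P" "q \<in> carrier P" for p q
    using that by (simp_all add: \<theta>_def j s(1) \<pi>_mult A.mult_closed)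
  have "l \<in> bilinear_maps K V P V"
    unfolding l_def
    by (rule bilinear_maps_restrictI) (auto intro!: i_eqI simp: j i s \<pi> \<pi>_mult mult_simps assms)
  moreover have "r \<in> bilinear_maps K P V V"
    unfolding r_def
    by (rule bilinear_maps_restrictI) (auto intro!: i_eqI simp: j i s \<pi> \<pi>_mult mult_simps assms)
  \<comment> \<open>Associativity moves the brackets: (i x s p) s q = i x (s p s q), a product of
    two elements of the image of \<open>i\<close>, hence zero. The axiom for \<open>r\<close> is
    symmetric.\<close>
  moreover have "l (l (x, p), q) = \<zero>\<^bsub>V\<^esub>" if "p \<in> carrier P" "q \<in> carrier P" "x \<in> carrier V" for p q x
  proof (rule i_eqI)
    have "i (l (l (x, p), q)) = i x \<otimes>\<^bsub>A\<^esub> i (\<theta> (p, q))"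
      using that by (simp add: il i\<theta> i s A.mult_assoc)
    then show "i (l (l (x, p), q)) = i \<zero>\<^bsub>V\<^esub>"
      using that by (simp add: i_mult i\<theta>(1) i0)
  qed (use that in \<open>simp_all add: il\<close>)
  moreover have "r (p, r (q, x)) = \<zero>\<^bsub>V\<^esub>" if "p \<in> carrier P" "q \<in> carrier P" "x \<in> carrier V" for p q x
  proof (rule i_eqI)
    have "i (r (p, r (q, x))) = i (\<theta> (p, q)) \<otimes>\<^bsub>A\<^esub> i x"
      using that by (simp add: ir i\<theta> i s A.mult_assoc)
    then show "i (r (p, r (q, x))) = i \<zero>\<^bsub>V\<^esub>"
      using that by (simp add: i_mult i\<theta>(1) i0)
  qed (use that in \<open>simp_all add: ir\<close>)
  \<comment> \<open>Both sides are sent by \<open>i\<close> to the triple product s p, i x, s q,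
    bracketed in the two ways.\<close>
  moreover have "r (p, l (x, q)) = l (r (p, x), q)"
    if "p \<in> carrier P" "q \<in> carrier P" "x \<in> carrier V" for p q x
    by (rule i_eqI) (use that in \<open>simp_all add: il ir i s A.mult_assoc\<close>)
  ultimately have b: "(l, r) \<in> discrete_bimodules K P V"
    by (simp add: discrete_bimodules_def)
  have "\<theta> \<in> bilinear_maps K P P V"
    unfolding \<theta>_def
    by (rule bilinear_maps_restrictI) (auto intro!: i_eqI simp: j i s \<pi> \<pi>_mult mult_simps assms)
  \<comment> \<open>The cocycle identity is associativity for s p, s q, s t.\<close>
  moreover have "r (p, \<theta> (q, t)) = l (\<theta> (p, q), t)"
    if "p \<in> carrier P" "q \<in> carrier P" "t \<in> carrier P" for p q t
    by (rule i_eqI) (use that in \<open>simp_all add: il ir i\<theta> s A.mult_assoc\<close>)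
  ultimately have \<theta>: "\<theta> \<in> DZ2 K P V (l, r)"
    by (simp add: DZ2_def)
  let ?M = "metabelian_product P V (l, r) \<theta>"
  have s0: "s \<zero>\<^bsub>P\<^esub> = \<zero>\<^bsub>A\<^esub>"
    by (rule linear_maps_zero[OF assms(1) E'(3) s_lin])
  \<comment> \<open>Expanding (s p + i x)(s q + i y) gives four products: i x i y vanishes and the
    other three are the images under \<open>i\<close> of the terms in the metabelian
    product.\<close>
  have "(\<lambda>(p, x). s p \<oplus>\<^bsub>A\<^esub> i x) \<in> algebra_morphisms K ?M A"
    by (auto simp: algebra_morphisms_def linear_maps_def s i s0 il ir i\<theta> i_mult mult_simps
        A.smult_r_distr A.M.a_ac)
  moreover have "\<pi> (i x) = \<zero>\<^bsub>P\<^esub>" if "x \<in> carrier V" for x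
    using that E'(9) by blast
  ultimately have "equivalent_extensions K (trivial_algebra V)
      (metabelian_extension P V (l, r) \<theta>) (A, i, \<pi>)"
    unfolding equivalent_extensions_def metabelian_extension_def split_conv
    by (intro bexI[of _ "\<lambda>(p, x). s p \<oplus>\<^bsub>A\<^esub> i x"]) (auto simp: s0 i s \<pi> \<pi>s)
  with b \<theta> show ?thesis
    by (rule that)
qed

text \<open>Being cohomologous is equivalence of the associated metabelian extensions over the same
  bimodule structure, so reflexivity, symmetry and transitivity are inherited from
  extensions.\<close>

lemma cohomologous_equiv:
  assumes "field K" "module K P" "module K V" and b: "b \<in> discrete_bimodules K P V"
  shows "equiv (DZ2 K P V b) (cohomologous K P V b)"
proof (rule equivI)
  note iff = metabelian_equivalent_iff[OF assms(2,3) b _ b]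
  note ext = is_extension_metabelian[OF assms]
  note mods = module_trivial_algebra[OF assms(2)] module_trivial_algebra[OF assms(3)]
  have mem: "\<theta> \<in> DZ2 K P V b" "\<theta>' \<in> DZ2 K P V b" if "(\<theta>, \<theta>') \<in> cohomologous K P V b" for \<theta> \<theta>'
    using that by (auto simp: cohomologous_def split: prod.splits)
  show "cohomologous K P V b \<subseteq> DZ2 K P V b \<times> DZ2 K P V b"
    using mem by auto
  show "refl_on (DZ2 K P V b) (cohomologous K P V b)"
  proof (rule refl_onI)
    show "(\<theta>, \<theta>) \<in> cohomologous K P V b" if "\<theta> \<in> DZ2 K P V b" for \<theta>
      using iff[OF that that] by (simp add: equivalent_extensions_refl)
  qed
  show "sym (cohomologous K P V b)"
  proof (rule symI)
    show "(\<theta>', \<theta>) \<in> cohomologous K P V b" if "(\<theta>, \<theta>') \<in> cohomologous K P V b" for \<theta> \<theta>'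
      using that iff[OF mem[OF that]] iff[OF mem(2,1)[OF that]]
        equivalent_extensions_sym[OF mods ext[OF mem(1)[OF that]] ext[OF mem(2)[OF that]]]
      by simp
  qed
  show "trans (cohomologous K P V b)"
  proof (rule transI)
    fix \<theta> \<theta>' \<theta>''
    assume *: "(\<theta>, \<theta>') \<in> cohomologous K P V b" "(\<theta>', \<theta>'') \<in> cohomologous K P V b"
    then have "equivalent_extensions K (trivial_algebra V)
        (metabelian_extension P V b \<theta>) (metabelian_extension P V b \<theta>'')"
      using iff[OF mem[OF *(1)]] iff[OF mem[OF *(2)]] by (blast intro: equivalent_extensions_trans)
    then show "(\<theta>, \<theta>'') \<in> cohomologous K P V b"
      using iff[OF mem(1)[OF *(1)] mem(2)[OF *(2)]] by simp
  qed
qed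

section \<open>The bijection between cohomology classes and extension classes\<close>

theorem theorem2p6:
  fixes K :: "('k, 'm) ring_scheme"
    and V :: "('k, 'v) module"
    and P :: "('k, 'p) module"
    and emb :: "'p \<times> 'v \<Rightarrow> 'u"
  assumes "field K" and "module K V" and "module K P"
    and "inj_on emb (carrier P \<times> carrier V)"
  shows "\<exists>\<Phi>. bij_betw \<Phi> (SIGMA b : discrete_bimodules K P V. DH2 K P V b)
        (Ext K (trivial_algebra P) (trivial_algebra V)
          :: ('k, 'v, 'u, 'p) extension set set) \<and>
      (\<forall>b \<in> discrete_bimodules K P V. \<forall>\<theta> \<in> DZ2 K P V b.
        \<Phi> (b, cohomologous K P V b `` {\<theta>}) =
          extension_class K (trivial_algebra P) (trivial_algebra V) (metabelian_extension P V b \<theta>))"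
proof -
  let ?P = "trivial_algebra P" and ?V = "trivial_algebra V"
  let ?M = "metabelian_extension P V" and ?coh = "cohomologous K P V"
  let ?Ext = "Ext K ?P ?V :: ('k, 'v, 'u, 'p) extension set set"
  let ?S = "SIGMA b : discrete_bimodules K P V. DH2 K P V b"
  define cls :: "_ \<Rightarrow> ('k, 'v, 'u, 'p) extension set"
    where "cls b\<theta> = extension_class K ?P ?V (?M (fst b\<theta>) (snd b\<theta>))" for b\<theta>
  \<comment> \<open>A class is evaluated at an arbitrary representative; independence of that choice
    is shown below, once equality of values of \<open>cls\<close> is understood.\<close>
  define \<Phi> where "\<Phi> = (\<lambda>(b, C). cls (b, SOME \<theta>. \<theta> \<in> C))"
  note mods = module_trivial_algebra[OF assms(3)] module_trivial_algebra[OF assms(2)]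
  note ext = is_extension_metabelian[OF assms(1,3,2)]
  note iff = metabelian_equivalent_iff[OF assms(3,2)]
  note equiv = cohomologous_equiv[OF assms(1,3,2)]
  \<comment> \<open>Transporting along \<open>emb\<close> shows that the class of each metabelian
    extension is nonempty in the type \<open>'u\<close>.\<close>
  have copy: "\<exists>F :: ('k, 'v, 'u, 'p) extension.
      is_extension K ?P ?V F \<and> equivalent_extensions K ?V (?M b \<theta>) F"
    if "b \<in> discrete_bimodules K P V" "\<theta> \<in> DZ2 K P V b" for b \<theta>
  proof -
    have "inj_on emb (carrier (metabelian_product P V b \<theta>))"
      using assms(4) by simp
    then show ?thesis
      using extension_transport[OF ext[OF that, unfolded metabelian_extension_def]]
      unfolding metabelian_extension_def by blast
  qed
  \<comment> \<open>One direction makes \<Phi> well defined on cohomology classes, the other makes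
    it injective, also across different bimodule structures.\<close>
  have cls_eq_iff: "cls (b, \<theta>) = cls (b', \<theta>') \<longleftrightarrow> b = b' \<and> (\<theta>, \<theta>') \<in> ?coh b"
    if mem: "b \<in> discrete_bimodules K P V" "\<theta> \<in> DZ2 K P V b"
      "b' \<in> discrete_bimodules K P V" "\<theta>' \<in> DZ2 K P V b'" for b \<theta> b' \<theta>'
  proof -
    have "cls (b, \<theta>) = cls (b', \<theta>') \<longleftrightarrow> equivalent_extensions K ?V (?M b \<theta>) (?M b' \<theta>')"
    proof
      assume eq: "cls (b, \<theta>) = cls (b', \<theta>')"
      obtain F where "F \<in> cls (b, \<theta>)"
        using copy[OF mem(1,2)] by (auto simp: cls_def extension_class_def)
      with eq show "equivalent_extensions K ?V (?M b \<theta>) (?M b' \<theta>')"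
        using equivalent_extensionsI[OF mods ext[OF mem(1,2)] ext[OF mem(3,4)], of F]
        by (simp add: cls_def)
    next
      assume "equivalent_extensions K ?V (?M b \<theta>) (?M b' \<theta>')"
      then show "cls (b, \<theta>) = cls (b', \<theta>')"
        using extension_class_eqI[OF mods ext[OF mem(1,2)] ext[OF mem(3,4)]]
        by (simp add: cls_def)
    qed
    with iff[OF mem] show ?thesis
      by blast
  qed
  have \<Phi>: "\<Phi> (b, ?coh b `` {\<theta>}) = cls (b, \<theta>)"
    if "b \<in> discrete_bimodules K P V" "\<theta> \<in> DZ2 K P V b" for b \<theta>
  proof -
    define \<theta>' where "\<theta>' = (SOME \<theta>'. \<theta>' \<in> ?coh b `` {\<theta>})"
    have "\<theta> \<in> ?coh b `` {\<theta>}"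
      by (rule equiv_class_self[OF equiv[OF that(1)] that(2)])
    then have "\<theta>' \<in> ?coh b `` {\<theta>}"
      unfolding \<theta>'_def by (rule someI[of "\<lambda>\<theta>'. \<theta>' \<in> ?coh b `` {\<theta>}"])
    then have "(\<theta>, \<theta>') \<in> ?coh b" "\<theta>' \<in> DZ2 K P V b"
      using equiv_type[OF equiv[OF that(1)]] by auto
    then show ?thesis
      using cls_eq_iff[OF that that(1), of \<theta>'] by (simp add: \<Phi>_def \<theta>'_def)
  qed
  have S: "\<exists>b \<theta>. u = (b, ?coh b `` {\<theta>}) \<and> b \<in> discrete_bimodules K P V \<and> \<theta> \<in> DZ2 K P V b"
    if "u \<in> ?S" for u
    using that by (auto simp: DH2_def elim!: quotientE)
  have "inj_on \<Phi> ?S"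
  proof (rule inj_onI)
    fix u u' assume u: "u \<in> ?S" "u' \<in> ?S" "\<Phi> u = \<Phi> u'"
    obtain b \<theta> b' \<theta>' where *: "u = (b, ?coh b `` {\<theta>})" "u' = (b', ?coh b' `` {\<theta>'})"
      "b \<in> discrete_bimodules K P V" "\<theta> \<in> DZ2 K P V b"
      "b' \<in> discrete_bimodules K P V" "\<theta>' \<in> DZ2 K P V b'"
      using S[OF u(1)] S[OF u(2)] by blast
    then have "cls (b, \<theta>) = cls (b', \<theta>')"
      using u(3) by (simp add: \<Phi>)
    then have "b = b'" "(\<theta>, \<theta>') \<in> ?coh b"
      using cls_eq_iff[OF *(3-6)] by blast+
    then show "u = u'"
      using * equiv_class_eq[OF equiv] by blast
  qed
  moreover have "\<Phi> u \<in> ?Ext" if u_mem: "u \<in> ?S" for u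
  proof -
    obtain b \<theta> where u: "u = (b, ?coh b `` {\<theta>})" "b \<in> discrete_bimodules K P V" "\<theta> \<in> DZ2 K P V b"
      using S[OF u_mem] by blast
    obtain F :: "('k, 'v, 'u, 'p) extension" where
      F: "is_extension K ?P ?V F" "equivalent_extensions K ?V (?M b \<theta>) F"
      using copy[OF u(2,3)] by blast
    \<comment> \<open>The metabelian extension itself lives on pairs, whereas \<open>Ext\<close> is
      formed in \<open>'u\<close>; its class is therefore rewritten as that of the copy
      \<open>F\<close>.\<close>
    have "\<Phi> u = extension_class K ?P ?V F"
      using extension_class_eqI[OF mods ext[OF u(2,3)] F] u by (simp add: \<Phi> cls_def)
    then show ?thesis
      using F(1) by (auto simp: Ext_eq)
  qed
  moreover have "X \<in> \<Phi> ` ?S" if X: "X \<in> ?Ext" for X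
  proof -
    obtain A :: "('k, 'u) module" and i \<pi>
      where E: "is_extension K ?P ?V (A, i, \<pi>)" "X = extension_class K ?P ?V (A, i, \<pi>)"
      using X by (auto simp: Ext_eq)
    obtain b \<theta> where b: "b \<in> discrete_bimodules K P V" "\<theta> \<in> DZ2 K P V b"
      "equivalent_extensions K ?V (?M b \<theta>) (A, i, \<pi>)"
      using extension_equivalent_metabelian[OF assms(3,2) E(1)] by metis
    have "X = \<Phi> (b, ?coh b `` {\<theta>})"
      using b(1,2) by (simp add: \<Phi> cls_def E(2)
          extension_class_eqI[OF mods ext[OF b(1,2)] E(1) b(3)])
    moreover have "(b, ?coh b `` {\<theta>}) \<in> ?S"
      using b by (simp add: DH2_def quotientI)
    ultimately show ?thesis
      by blast
  qed
  ultimately have "bij_betw \<Phi> ?S ?Ext"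
    by (auto simp: bij_betw_def)
  then show ?thesis
    using \<Phi> by (intro exI[of _ \<Phi>]) (simp add: cls_def)
qed

end
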